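(* Literals can be existentially quantified from a Decision-DNNF circuit in time linear in the circuit size while yielding a DNNF circuit. That is, there is an algorithm that, given a Decision-DNNF circuit $\Delta$ and a set of literals $\{\ell_1,\ldots,\ell_n\}$, outputs in time linear in the size of $\Delta$ a DNNF circuit that is logically equivalent to $\exists \ell_1,\ldots,\ell_n\cdot\Delta$.
   Context: An NNF circuit is a Boolean circuit (rooted directed acyclic graph) whose leaves are labelled with constants true/false or literals ($x$ or $\bar{x}$ for a Boolean variable $X$) and whose internal nodes are and-nodes or or-nodes; its size is the size of this graph. An NNF circuit is decomposable if for every and-node the sets of variables of its children $\alpha_1,\ldots,\alpha_k$ are pairwise disjoint. A DNNF circuit is a decomposable NNF circuit. A Decision-DNNF circuit is a DNNF circuit in which every or-node has the form $(\ell\wedge\alpha)\vee(\bar{\ell}\wedge\beta)$ for some literal $\ell$. Conditioning: $\varphi|x$ (resp. $\varphi|\bar{x}$) is obtained by replacing every occurrence of variable $X$ in $\varphi$ with true (resp. false). Existential literal quantification is $\exists \ell\cdot\varphi=(\varphi|\ell)\vee(\bar{\ell}\wedge(\varphi|\bar{\ell}))$ (with $\bar{\ell}$ the complement of $\ell$); several literals are quantified successively (the order does not matter up to logical equivalence). *)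

theory Defs
  imports Main
begin

section \<open>Literals and circuits\<close>

datatype lit = Pos nat | Neg nat

fun var :: "lit \<Rightarrow> nat" where
  "var (Pos x) = x"
| "var (Neg x) = x"

fun compl :: "lit \<Rightarrow> lit" where
  "compl (Pos x) = Neg x"
| "compl (Neg x) = Pos x"

fun lit_true :: "(nat \<Rightarrow> bool) \<Rightarrow> lit \<Rightarrow> bool" where
  "lit_true w (Pos x) = w x"
| "lit_true w (Neg x) = (\<not> w x)"

text \<open>The nodes of a circuit are the positions of its gate list; the arguments of \<open>And\<close> and \<open>Or\<close>
  are the positions of the children, so subcircuits may be shared. No topological order of the
  positions is imposed.\<close>

datatype gate = Const bool | Literal lit | And "nat list" | Or "nat list"

datatype circuit = Circuit (gates: "gate list") (root: nat)

fun children :: "gate \<Rightarrow> nat list" where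
  "children (And js) = js"
| "children (Or js) = js"
| "children (Const b) = []"
| "children (Literal l) = []"

definition arcs :: "circuit \<Rightarrow> (nat \<times> nat) set" where
  "arcs C = {(i, j). i < length (gates C) \<and> j \<in> set (children (gates C ! i))}"

definition circuit_size :: "circuit \<Rightarrow> nat" where
  "circuit_size C = length (gates C) + card (arcs C)"

definition nnf :: "circuit \<Rightarrow> bool" where
  "nnf C \<longleftrightarrow>
     root C < length (gates C) \<and>
     (\<forall>g \<in> set (gates C). distinct (children g) \<and> set (children g) \<subseteq> {..<length (gates C)}) \<and>
     And [] \<notin> set (gates C) \<and> Or [] \<notin> set (gates C) \<and>
     acyclic (arcs C) \<and>
     (\<forall>i < length (gates C). (root C, i) \<in> (arcs C)\<^sup>*)"

definition vars_at :: "circuit \<Rightarrow> nat \<Rightarrow> nat set" where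
  "vars_at C i =
     {var l | j l. (i, j) \<in> (arcs C)\<^sup>* \<and> j < length (gates C) \<and> gates C ! j = Literal l}"

definition decomposable :: "circuit \<Rightarrow> bool" where
  "decomposable C \<longleftrightarrow>
     (\<forall>js. And js \<in> set (gates C) \<longrightarrow>
        (\<forall>p < length js. \<forall>q < length js. p \<noteq> q \<longrightarrow>
           vars_at C (js ! p) \<inter> vars_at C (js ! q) = {}))"

definition dnnf :: "circuit \<Rightarrow> bool" where
  "dnnf C \<longleftrightarrow> nnf C \<and> decomposable C"

definition guarded_by :: "circuit \<Rightarrow> lit \<Rightarrow> nat \<Rightarrow> bool" where
  "guarded_by C l i \<longleftrightarrow>
     (\<exists>x \<alpha>. (gates C ! i = And [x, \<alpha>] \<or> gates C ! i = And [\<alpha>, x]) \<and> gates C ! x = Literal l)"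

text \<open>Exchanging the two disjuncts amounts to exchanging the literal and its complement, so the
  order of the children of the or-gate is immaterial.\<close>

definition decision_dnnf :: "circuit \<Rightarrow> bool" where
  "decision_dnnf C \<longleftrightarrow> dnnf C \<and>
     (\<forall>js. Or js \<in> set (gates C) \<longrightarrow>
        (\<exists>l a b. js = [a, b] \<and> guarded_by C l a \<and> guarded_by C (compl l) b))"

text \<open>Truth of a node under an assignment. On an acyclic circuit these clauses have exactly one
  solution, so taking the least one is only a way to recurse over the graph.\<close>

inductive holds :: "circuit \<Rightarrow> (nat \<Rightarrow> bool) \<Rightarrow> nat \<Rightarrow> bool" for C w where
  "i < length (gates C) \<Longrightarrow> gates C ! i = Const True \<Longrightarrow> holds C w i"
| "i < length (gates C) \<Longrightarrow> gates C ! i = Literal l \<Longrightarrow> lit_true w l \<Longrightarrow> holds C w i"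
| "i < length (gates C) \<Longrightarrow> gates C ! i = And js \<Longrightarrow> (\<forall>j \<in> set js. holds C w j) \<Longrightarrow> holds C w i"
| "i < length (gates C) \<Longrightarrow> gates C ! i = Or js \<Longrightarrow> (\<exists>j \<in> set js. holds C w j) \<Longrightarrow> holds C w i"

definition equivalent :: "circuit \<Rightarrow> circuit \<Rightarrow> bool" where
  "equivalent C D \<longleftrightarrow> (\<forall>w. holds C w (root C) = holds D w (root D))"


section \<open>Conditioning and existential literal quantification\<close>

fun condition_gate :: "lit \<Rightarrow> gate \<Rightarrow> gate" where
  "condition_gate l (Literal k) =
     (if k = l then Const True else if k = compl l then Const False else Literal k)"
| "condition_gate l (Const b) = Const b"
| "condition_gate l (And js) = And js"
| "condition_gate l (Or js) = Or js"

definition condition :: "lit \<Rightarrow> circuit \<Rightarrow> circuit" where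
  "condition l C = Circuit (map (condition_gate l) (gates C)) (root C)"

fun shift_gate :: "nat \<Rightarrow> gate \<Rightarrow> gate" where
  "shift_gate n (And js) = And (map (\<lambda>j. n + j) js)"
| "shift_gate n (Or js) = Or (map (\<lambda>j. n + j) js)"
| "shift_gate n (Const b) = Const b"
| "shift_gate n (Literal l) = Literal l"

text \<open>The circuit \<open>(C | l) \<or> (compl l \<and> (C | compl l))\<close>: the two conditioned copies of \<open>C\<close> occupy
  the positions below \<open>n\<close> and those from \<open>n\<close> to \<open>2 * n - 1\<close>.\<close>

definition exists_lit :: "lit \<Rightarrow> circuit \<Rightarrow> circuit" where
  "exists_lit l C =
     (let n = length (gates C) in
      Circuit
        (gates (condition l C) @
         map (shift_gate n) (gates (condition (compl l) C)) @
         [Literal (compl l),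
          And [2 * n, n + root C],
          Or [root C, 2 * n + 1]])
        (2 * n + 2))"

definition exists_lits :: "lit list \<Rightarrow> circuit \<Rightarrow> circuit" where
  "exists_lits ls C = foldr exists_lit ls C"


section \<open>A random access machine\<close>

text \<open>Unit-cost RAM over the natural numbers with addition and truncated subtraction. Registers are
  named by the program, memory is addressed indirectly. Every instruction takes one step, and the
  machine halts when the program counter leaves the program.\<close>

datatype instr =
    LoadConst nat nat
  | Add nat nat nat
  | Sub nat nat nat
  | Load nat nat
  | Store nat nat
  | JumpZero nat nat

datatype config = Config (pc: nat) (regs: "nat \<Rightarrow> nat") (mem: "nat \<Rightarrow> nat")

fun exec :: "instr \<Rightarrow> config \<Rightarrow> config" where
  "exec (LoadConst d k) (Config p r m) = Config (p + 1) (r(d := k)) m"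
| "exec (Add d a b) (Config p r m) = Config (p + 1) (r(d := r a + r b)) m"
| "exec (Sub d a b) (Config p r m) = Config (p + 1) (r(d := r a - r b)) m"
| "exec (Load d a) (Config p r m) = Config (p + 1) (r(d := m (r a))) m"
| "exec (Store a s) (Config p r m) = Config (p + 1) r (m(r a := r s))"
| "exec (JumpZero a q) (Config p r m) = Config (if r a = 0 then q else p + 1) r m"

definition halted :: "instr list \<Rightarrow> config \<Rightarrow> bool" where
  "halted P s \<longleftrightarrow> length P \<le> pc s"

definition step :: "instr list \<Rightarrow> config \<Rightarrow> config" where
  "step P s = (if halted P s then s else exec (P ! pc s) s)"


section \<open>Inputs and outputs\<close>

fun lit_code :: "lit \<Rightarrow> nat" where
  "lit_code (Pos x) = 2 * x"
| "lit_code (Neg x) = 2 * x + 1"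

fun gate_words :: "gate \<Rightarrow> nat list" where
  "gate_words (Const b) = [0, of_bool b]"
| "gate_words (Literal l) = [1, lit_code l]"
| "gate_words (And js) = 2 # length js # js"
| "gate_words (Or js) = 3 # length js # js"

definition circuit_words :: "circuit \<Rightarrow> nat list" where
  "circuit_words C = root C # length (gates C) # concat (map gate_words (gates C))"

text \<open>The circuit is stored from address 0 on and is followed by the characteristic table of the
  set of literals, indexed by literal code. Register 1 holds the address of the table. Memory
  beyond the last literal of the set is zero.\<close>

definition initial :: "circuit \<Rightarrow> lit set \<Rightarrow> config" where
  "initial C L =
     (let ws = circuit_words C; n = length ws in
      Config 0 ((\<lambda>_. 0)(1 := n))
        (\<lambda>a. if a < n then ws ! a else of_bool (a - n \<in> lit_code ` L)))"

text \<open>A halted machine outputs the circuit stored at the address held by register 0.\<close>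

definition outputs :: "config \<Rightarrow> circuit \<Rightarrow> bool" where
  "outputs s D \<longleftrightarrow>
     (\<forall>i < length (circuit_words D). mem s (regs s 0 + i) = circuit_words D ! i)"

end

theory Submission
  imports Defs
begin

text \<open>An assignment \<open>w\<close> satisfies the quantified circuit iff some assignment \<open>w'\<close>
  satisfies the circuit and every literal true in \<open>w'\<close> but not in \<open>w\<close> is quantified. On a DNNF
  circuit this is computed by replacing every quantified literal by true: at an and-gate, witnesses
  for the children can be glued together because the children share no variables. The replacement
  keeps all arcs and the length of every gate encoding, so one pass over the input rewrites it in
  place, skipping the child lists.\<close>

section \<open>Semantics of literal quantification\<close>

definition forget_gate :: "lit set \<Rightarrow> gate \<Rightarrow> gate" where
  "forget_gate L g = (case g of Literal l \<Rightarrow> if l \<in> L then Const True else g | _ \<Rightarrow> g)"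

lemma forget_gate_simps [simp]:
  "forget_gate L (Const b) = Const b"
  "forget_gate L (Literal l) = (if l \<in> L then Const True else Literal l)"
  "forget_gate L (And js) = And js"
  "forget_gate L (Or js) = Or js"
  by (simp_all add: forget_gate_def)

lemma forget_gate_eq_iff [simp]:
  "forget_gate L g = And js \<longleftrightarrow> g = And js"
  "forget_gate L g = Or js \<longleftrightarrow> g = Or js"
  "forget_gate L g = Literal l \<longleftrightarrow> g = Literal l \<and> l \<notin> L"
  "forget_gate L g = Const b \<longleftrightarrow> g = Const b \<or> b \<and> (\<exists>l \<in> L. g = Literal l)"
  by (cases g; auto)+

lemma children_forget_gate [simp]: "children (forget_gate L g) = children g"
  by (cases g) auto

definition forget :: "lit set \<Rightarrow> circuit \<Rightarrow> circuit" where
  "forget L C = Circuit (map (forget_gate L) (gates C)) (root C)"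

lemma forget_simps [simp]:
  "gates (forget L C) = map (forget_gate L) (gates C)"
  "root (forget L C) = root C"
  by (simp_all add: forget_def)

lemma arcs_forget [simp]: "arcs (forget L C) = arcs C"
  by (auto simp: arcs_def)

text \<open>Replaced leaves lose their variables, so the inclusion may be strict; it is the
  direction in which disjointness of variable sets carries over.\<close>

lemma vars_at_forget: "vars_at (forget L C) i \<subseteq> vars_at C i"
  by (auto simp: vars_at_def) blast

lemma gate_in_forget_gates_iff [simp]:
  "And js \<in> forget_gate L ` A \<longleftrightarrow> And js \<in> A"
  "Or js \<in> forget_gate L ` A \<longleftrightarrow> Or js \<in> A"
  by (metis (no_types) forget_gate_eq_iff(1) image_iff)
     (metis (no_types) forget_gate_eq_iff(2) image_iff)

lemma dnnf_forget:
  assumes "dnnf C"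
  shows "dnnf (forget L C)"
proof -
  have "nnf (forget L C)"
    using assms by (simp add: dnnf_def nnf_def)
  moreover have "decomposable (forget L C)"
    unfolding decomposable_def
  proof (intro allI impI)
    fix js p q
    assume "And js \<in> set (gates (forget L C))" "p < length js" "q < length js" "p \<noteq> q"
    then have "vars_at C (js ! p) \<inter> vars_at C (js ! q) = {}"
      using assms by (simp add: dnnf_def decomposable_def)
    then show "vars_at (forget L C) (js ! p) \<inter> vars_at (forget L C) (js ! q) = {}"
      using vars_at_forget[of L C] by blast
  qed
  ultimately show ?thesis
    by (simp add: dnnf_def)
qed

section \<open>Assignments related by quantification\<close>

text \<open>\<open>w'\<close> may turn a variable \<open>x\<close> from false to true only if
  \<open>Pos x\<close> is in \<open>L\<close>, and from true to false only if \<open>Neg x\<close>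
  is in \<open>L\<close>.\<close>

definition extends_by :: "lit set \<Rightarrow> (nat \<Rightarrow> bool) \<Rightarrow> (nat \<Rightarrow> bool) \<Rightarrow> bool" where
  "extends_by L w w' \<longleftrightarrow> (\<forall>k. lit_true w' k \<longrightarrow> lit_true w k \<or> k \<in> L)"

text \<open>Semantic counterpart of conditioning on \<open>l\<close>; the new value is the polarity
  of \<open>l\<close>.\<close>

definition make_true :: "lit \<Rightarrow> (nat \<Rightarrow> bool) \<Rightarrow> nat \<Rightarrow> bool" where
  "make_true l w = w(var l := (l = Pos (var l)))"

lemma lit_true_compl [simp]: "lit_true w (compl l) \<longleftrightarrow> \<not> lit_true w l"
  by (cases l) auto

lemma compl_simps [simp]: "compl (compl l) = l" "compl l \<noteq> l" "l \<noteq> compl l" "var (compl l) = var l"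
  by (cases l; simp)+

lemma lit_true_make_true:
  "lit_true (make_true l w) k \<longleftrightarrow> k = l \<or> k \<noteq> compl l \<and> lit_true w k"
  by (cases k; cases l) (auto simp: make_true_def)

lemma make_true_idem: "lit_true w l \<Longrightarrow> make_true l w = w"
  by (cases l) (auto simp: make_true_def fun_upd_idem)

lemma lit_true_cong: "w (var l) = w' (var l) \<Longrightarrow> lit_true w l = lit_true w' l"
  by (cases l) auto

text \<open>The two disjuncts mirror those of \<open>exists_lit\<close>. If \<open>l\<close> is true
  in \<open>w\<close>, inserting it permits nothing new; otherwise they separate the
  \<open>w'\<close> that make \<open>l\<close> true from those that do not.\<close>

lemma extends_by_insert:
  "extends_by (insert l L) w w' \<longleftrightarrow>
     extends_by L (make_true l w) w' \<or> lit_true w (compl l) \<and> extends_by L w w'"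
proof (cases "lit_true w l")
  case True
  then show ?thesis
    by (auto simp: extends_by_def make_true_idem)
next
  case False
  then show ?thesis
    unfolding extends_by_def lit_true_make_true
    by (metis compl_simps(1) insert_iff lit_true_compl)
qed

section \<open>Truth at the nodes of the rewritten circuit\<close>

lemma holds_simps:
  "holds C w i \<longleftrightarrow> i < length (gates C) \<and>
     (case gates C ! i of Const b \<Rightarrow> b | Literal l \<Rightarrow> lit_true w l
      | And js \<Rightarrow> \<forall>j \<in> set js. holds C w j | Or js \<Rightarrow> \<exists>j \<in> set js. holds C w j)"
  by (subst holds.simps) (auto split: gate.splits)

lemma vars_at_child:
  assumes "i < length (gates C)" "j \<in> set (children (gates C ! i))"
  shows "vars_at C j \<subseteq> vars_at C i"
proof -
  have "(i, j) \<in> arcs C"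
    using assms by (simp add: arcs_def)
  then show ?thesis
    unfolding vars_at_def by (auto intro: converse_rtrancl_into_rtrancl)
qed

text \<open>Lets a witness for a child be altered freely outside the variables below that
  child.\<close>

lemma holds_cong_vars_at:
  assumes "holds C w i" "\<And>x. x \<in> vars_at C i \<Longrightarrow> w x = w' x"
  shows "holds C w' i"
  using assms
proof (induction rule: holds.induct)
  case (1 i)
  then show ?case
    by (simp add: holds.intros(1))
next
  case (2 i l)
  have "var l \<in> vars_at C i"
    using 2(1,2) by (auto simp: vars_at_def)
  then have "lit_true w' l"
    using 2(3,4) lit_true_cong by blast
  then show ?case
    by (rule holds.intros(2)[OF 2(1,2)])
next
  case (3 i js)
  have "vars_at C j \<subseteq> vars_at C i" if "j \<in> set js" for j
    using vars_at_child[of i C j] 3(1,2) that by simp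
  then have "w x = w' x" if "j \<in> set js" "x \<in> vars_at C j" for j x
    using 3(4) that by blast
  then show ?case
    using 3(3) by (intro holds.intros(3)[OF 3(1,2)]) blast
next
  case (4 i js)
  have "vars_at C j \<subseteq> vars_at C i" if "j \<in> set js" for j
    using vars_at_child[of i C j] 4(1,2) that by simp
  then have "w x = w' x" if "j \<in> set js" "x \<in> vars_at C j" for j x
    using 4(4) that by blast
  then show ?case
    using 4(3) by (intro holds.intros(4)[OF 4(1,2)]) blast
qed

text \<open>Negation occurs only at leaves, so truth is monotone in the leaves; a literal true under
  \<open>w'\<close> is either true under \<open>w\<close> or replaced by true.\<close>

lemma holds_forget_if_extends_by:
  assumes "holds C w' i" "extends_by L w w'"
  shows "holds (forget L C) w i"
  using assms
proof (induction rule: holds.induct)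
  case (2 i l)
  then show ?case
    by (subst holds_simps) (auto simp: extends_by_def)
qed (subst holds_simps, auto)+

text \<open>The condition concerns one literal, hence one variable, at a time, so \<open>u\<close>
  may differ from variable to variable.\<close>

lemma extends_by_glue:
  assumes "\<And>x. \<exists>u. extends_by L w u \<and> w' x = u x"
  shows "extends_by L w w'"
  unfolding extends_by_def by (metis assms extends_by_def lit_true_cong)

lemma extends_by_refl: "extends_by L w w"
  by (simp add: extends_by_def)

text \<open>A replaced leaf is witnessed by making its literal true, and an or-gate inherits the
  witness of a child. Only and-gates combine several witnesses, which is where decomposability
  enters.\<close>

lemma holds_forgetD:
  assumes "holds (forget L C) w i" "decomposable C"
  shows "\<exists>w'. extends_by L w w' \<and> holds C w' i"
  using assms(1)
proof (induction rule: holds.induct)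
  case (1 i)
  then consider "gates C ! i = Const True" | l where "l \<in> L" "gates C ! i = Literal l"
    by auto
  then show ?case
  proof cases
    case 1
    with \<open>i < length (gates (forget L C))\<close> show ?thesis
      by (auto intro: extends_by_refl holds.intros)
  next
    case (2 l)
    then have "extends_by L w (make_true l w)"
      by (auto simp: extends_by_def lit_true_make_true)
    moreover have "holds C (make_true l w) i"
      using 2 1 by (auto simp: lit_true_make_true intro: holds.intros)
    ultimately show ?thesis
      by blast
  qed
next
  case (2 i l)
  then show ?case
    by (auto intro: extends_by_refl holds.intros)
next
  case (3 i js)
  then have i: "i < length (gates C)" "gates C ! i = And js"
    by auto
  from 3 obtain u where u: "extends_by L w (u j)" "holds C (u j) j" if "j \<in> set js" for j
    by metis
  \<comment> \<open>\<open>pick x\<close> is the child whose witness decides \<open>x\<close>;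
    disjointness makes it unique. Variables below no child keep their value from
    \<open>w\<close>.\<close>
  define pick where "pick x = (SOME j. j \<in> set js \<and> x \<in> vars_at C j)" for x
  define w' where
    "w' x = (if \<exists>j \<in> set js. x \<in> vars_at C j then u (pick x) x else w x)" for x
  have pick: "pick x \<in> set js" "x \<in> vars_at C (pick x)" if "j \<in> set js" "x \<in> vars_at C j" for j x
    using that unfolding pick_def by (metis (mono_tags, lifting) someI_ex)+
  \<comment> \<open>Decomposability separates list positions; different children sit at different
    positions.\<close>
  have disjoint: "vars_at C j \<inter> vars_at C j' = {}" if "j \<in> set js" "j' \<in> set js" "j \<noteq> j'" for j j'
    using assms(2) i that unfolding decomposable_def by (metis in_set_conv_nth nth_mem)
  have "extends_by L w w'"
  proof (rule extends_by_glue)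
    show "\<exists>v. extends_by L w v \<and> w' x = v x" for x
      unfolding w'_def using u(1) pick extends_by_refl by metis
  qed
  moreover have "holds C w' j" if j: "j \<in> set js" for j
  proof (rule holds_cong_vars_at[OF u(2)[OF j]])
    fix x assume x: "x \<in> vars_at C j"
    then have "pick x = j"
      using disjoint[OF j] pick[OF j x] by blast
    with x j show "u j x = w' x"
      by (auto simp: w'_def)
  qed
  ultimately show ?case
    using i by (auto intro: holds.intros)
next
  case (4 i js)
  then show ?case
    by (auto intro: holds.intros)
qed

lemma holds_forget:
  assumes "decomposable C"
  shows "holds (forget L C) w i \<longleftrightarrow> (\<exists>w'. extends_by L w w' \<and> holds C w' i)"
  using assms holds_forgetD holds_forget_if_extends_by by blast

section \<open>Semantics of the quantified circuit\<close>

text \<open>The part of \<open>nnf\<close> on which relocating a gate list relies: no reference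
  leaves the list.\<close>

definition closed_circuit :: "circuit \<Rightarrow> bool" where
  "closed_circuit C \<longleftrightarrow> root C < length (gates C) \<and>
     (\<forall>g \<in> set (gates C). set (children g) \<subseteq> {..<length (gates C)})"

section \<open>Conditioning and relocated copies\<close>

lemma condition_simps [simp]:
  "gates (condition l C) = map (condition_gate l) (gates C)"
  "root (condition l C) = root C"
  by (simp_all add: condition_def)

lemma children_condition_gate [simp]: "children (condition_gate l g) = children g"
  by (cases g) auto

lemma children_shift_gate [simp]: "children (shift_gate n g) = map ((+) n) (children g)"
  by (cases g) auto

text \<open>Makes the first copy in \<open>exists_lit\<close> an instance of
  \<open>holds_shifted\<close> at offset 0.\<close>

lemma shift_gate_0 [simp]: "shift_gate 0 g = g"
  by (cases g) (auto simp: map_idI)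

lemma holds_condition: "holds (condition l C) w i \<longleftrightarrow> holds C (make_true l w) i"
proof
  assume "holds (condition l C) w i"
  then show "holds C (make_true l w) i"
  proof (induction rule: holds.induct)
    case (1 i)
    then show ?case
      by (subst holds_simps, cases "gates C ! i")
         (auto simp: lit_true_make_true split: if_splits)
  next
    case (2 i k)
    then show ?case
      by (subst holds_simps, cases "gates C ! i")
         (auto simp: lit_true_make_true split: if_splits)
  next
    case (3 i js)
    then show ?case
      by (subst holds_simps, cases "gates C ! i") (auto split: if_splits)
  next
    case (4 i js)
    then show ?case
      by (subst holds_simps, cases "gates C ! i") (auto split: if_splits)
  qed
next
  assume "holds C (make_true l w) i"
  then show "holds (condition l C) w i"
  proof (induction rule: holds.induct)
    case (2 i k)
    then show ?case
      by (subst holds_simps) (auto simp: lit_true_make_true)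
  qed (subst holds_simps, auto)+
qed

text \<open>The gates of \<open>E\<close> from \<open>k\<close> on form a relocated copy of
  \<open>C\<close>; no child reference leaves it, so its truth values do not depend on the rest of
  \<open>E\<close>.\<close>

lemma holds_shifted:
  assumes closed: "\<forall>g \<in> set (gates C). set (children g) \<subseteq> {..<length (gates C)}"
    and len: "k + length (gates C) \<le> length (gates E)"
    and gates: "\<And>i. i < length (gates C) \<Longrightarrow> gates E ! (k + i) = shift_gate k (gates C ! i)"
    and "i < length (gates C)"
  shows "holds E w (k + i) \<longleftrightarrow> holds C w i"
proof
  \<comment> \<open>Keeps the induction over derivations in \<open>E\<close> inside the copy, where
    the hypothesis applies.\<close>
  have below: "j < length (gates C)"
    if "i < length (gates C)" "j \<in> set (children (gates C ! i))" for i j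
    using closed that by (meson lessThan_iff nth_mem subsetD)
  assume "holds E w (k + i)"
  then show "holds C w i"
    using \<open>i < length (gates C)\<close>
  proof (induction "k + i" arbitrary: i rule: holds.induct)
    case 1
    with gates[of i] show ?case
      by (subst holds_simps, cases "gates C ! i") auto
  next
    case (2 l)
    with gates[of i] show ?case
      by (subst holds_simps, cases "gates C ! i") auto
  next
    case (3 js)
    with gates[of i] below[of i] show ?case
      by (subst holds_simps, cases "gates C ! i") auto
  next
    case (4 js)
    with gates[of i] below[of i] show ?case
      by (subst holds_simps, cases "gates C ! i") auto
  qed
next
  assume "holds C w i"
  then show "holds E w (k + i)"
  proof (induction rule: holds.induct)
    case (1 i)
    with gates[of i] len show ?case by (subst holds_simps) auto
  next
    case (2 i l)
    with gates[of i] len show ?case by (subst holds_simps) auto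
  next
    case (3 i js)
    with gates[of i] len show ?case by (subst holds_simps) auto
  next
    case (4 i js)
    with gates[of i] len show ?case by (subst holds_simps) auto
  qed
qed

lemma closed_exists_lit:
  assumes "closed_circuit C"
  shows "closed_circuit (exists_lit l C)"
  using assms unfolding closed_circuit_def exists_lit_def Let_def
  by (fastforce simp: subset_iff)

lemma holds_exists_lit:
  assumes "closed_circuit C"
  shows "holds (exists_lit l C) w (root (exists_lit l C)) \<longleftrightarrow>
     holds C (make_true l w) (root C) \<or> lit_true w (compl l) \<and> holds C w (root C)"
proof -
  define n where "n = length (gates C)"
  let ?E = "exists_lit l C"
  have root: "root C < n"
    using assms by (simp add: closed_circuit_def n_def)
  have E: "gates ?E = gates (condition l C) @
        map (shift_gate n) (gates (condition (compl l) C)) @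
        [Literal (compl l), And [2 * n, n + root C], Or [root C, 2 * n + 1]]"
    "root ?E = 2 * n + 2"
    by (simp_all add: exists_lit_def Let_def n_def)
  have len: "length (gates ?E) = 2 * n + 3"
    by (simp add: E n_def)
  have nths: "gates ?E ! (2 * n) = Literal (compl l)"
    "gates ?E ! (2 * n + 1) = And [2 * n, n + root C]"
    "gates ?E ! (2 * n + 2) = Or [root C, 2 * n + 1]"
    by (simp_all add: E nth_append n_def)
  have "holds ?E w (0 + root C) \<longleftrightarrow> holds (condition l C) w (root C)"
    by (rule holds_shifted)
       (use assms root in \<open>auto simp: closed_circuit_def E nth_append n_def\<close>)
  then have first: "holds ?E w (root C) \<longleftrightarrow> holds C (make_true l w) (root C)"
    by (simp add: holds_condition)
  have "holds ?E w (n + root C) \<longleftrightarrow> holds (condition (compl l) C) w (root C)"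
    by (rule holds_shifted)
       (use assms root in \<open>auto simp: closed_circuit_def E nth_append n_def\<close>)
  then have second: "holds ?E w (n + root C) \<longleftrightarrow> holds C (make_true (compl l) w) (root C)"
    by (simp add: holds_condition)
  have lit: "holds ?E w (2 * n) \<longleftrightarrow> lit_true w (compl l)"
    by (subst holds_simps) (simp add: len nths)
  have conj: "holds ?E w (2 * n + 1) \<longleftrightarrow> holds ?E w (2 * n) \<and> holds ?E w (n + root C)"
    by (subst holds_simps) (simp add: len nths[simplified])
  have "holds ?E w (2 * n + 2) \<longleftrightarrow> holds ?E w (root C) \<or> holds ?E w (2 * n + 1)"
    by (subst holds_simps) (simp add: len nths[simplified])
  \<comment> \<open>In the second disjunct \<open>compl l\<close> is already true in
    \<open>w\<close>, so \<open>make_true (compl l) w\<close> is \<open>w\<close>.\<close>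
  then show ?thesis
    unfolding E(2) conj lit first second using make_true_idem by metis
qed

text \<open>Closedness is carried along because each further \<open>exists_lit\<close> relies on it;
  \<open>w\<close> is generalised because the outer literal changes the assignment.\<close>

lemma holds_exists_lits:
  assumes "closed_circuit C"
  shows "closed_circuit (exists_lits ls C) \<and>
    (holds (exists_lits ls C) w (root (exists_lits ls C)) \<longleftrightarrow>
     (\<exists>w'. extends_by (set ls) w w' \<and> holds C w' (root C)))"
proof (induction ls arbitrary: w)
  case Nil
  have "w' = w" if "extends_by {} w w'" for w'
  proof
    show "w' x = w x" for x
      using that[unfolded extends_by_def, rule_format, of "Pos x"]
        that[unfolded extends_by_def, rule_format, of "Neg x"] by auto
  qed
  then show ?case
    using assms extends_by_refl by (auto simp: exists_lits_def)
next
  case (Cons l ls)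
  then have closed: "closed_circuit (exists_lits ls C)"
    by blast
  have eq: "exists_lits (l # ls) C = exists_lit l (exists_lits ls C)"
    by (simp add: exists_lits_def)
  show ?case
    unfolding eq holds_exists_lit[OF closed] list.set extends_by_insert
    using Cons.IH closed_exists_lit[OF closed] by blast
qed

lemma equivalent_forget_exists_lits:
  assumes "dnnf C"
  shows "equivalent (forget (set ls) C) (exists_lits ls C)"
proof -
  have "closed_circuit C" "decomposable C"
    using assms by (auto simp: dnnf_def nnf_def closed_circuit_def)
  then show ?thesis
    by (simp add: equivalent_def holds_exists_lits holds_forget)
qed

section \<open>The machine program\<close>

text \<open>Registers: 0 is constantly zero (the output address, and the operand of unconditional jumps),
  1 the table address, 2 and 9 the constants one and two, 3 the number of gates left, 4 the address
  of the next gate. The loop starts at instruction 4.\<close>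

definition forget_prog :: "instr list" where
  "forget_prog =
    [LoadConst 2 1,
     Load 3 2,
     LoadConst 4 2,
     LoadConst 9 2,
     JumpZero 3 22,
     Load 5 4,
     Sub 3 3 2,
     Add 6 4 2,
     Load 7 6,
     Add 4 4 9,
     JumpZero 5 4,
     Sub 5 5 2,
     JumpZero 5 15,
     Add 4 4 7,
     JumpZero 0 4,
     Add 7 7 1,
     Load 8 7,
     JumpZero 8 4,
     Store 6 2,
     Sub 6 6 2,
     Store 6 0,
     JumpZero 0 4]"

section \<open>Execution and running time\<close>

lemma step_forget_prog:
  "k < 22 \<Longrightarrow> step forget_prog (Config k r m) = exec (forget_prog ! k) (Config k r m)"
  by (simp add: step_def halted_def forget_prog_def)

lemmas nth_forget_prog = arg_cong[OF forget_prog_def, of "\<lambda>P. P ! k" for k]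

lemma funpow_numeral: "(f ^^ numeral k) x = (f ^^ pred_numeral k) (f x)"
  by (simp add: numeral_eq_Suc funpow_swap1)

text \<open>\<open>gs\<close> are the gates still to be read, from address \<open>a\<close> on;
  \<open>N\<close> is the table address. Words already rewritten are left to the frame clauses of
  \<open>loop_step\<close> and \<open>loop\<close>.\<close>

definition loop_inv :: "nat \<Rightarrow> lit set \<Rightarrow> nat \<Rightarrow> gate list \<Rightarrow> config \<Rightarrow> bool" where
  "loop_inv N L a gs s \<longleftrightarrow>
     (let ws = concat (map gate_words gs) in
      pc s = 4 \<and> regs s 0 = 0 \<and> regs s 1 = N \<and> regs s 2 = 1 \<and> regs s 9 = 2 \<and>
      regs s 3 = length gs \<and> regs s 4 = a \<and> a + length ws \<le> N \<and>
      (\<forall>i < length ws. mem s (a + i) = ws ! i) \<and>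
      (\<forall>k. mem s (N + k) = of_bool (k \<in> lit_code ` L)))"

lemma inj_lit_code: "inj lit_code"
proof (rule injI)
  show "k = l" if "lit_code k = lit_code l" for k l
    using that by (cases k; cases l; simp; presburger)
qed

lemma length_gate_words_forget [simp]:
  "length (gate_words (forget_gate L g)) = length (gate_words g)"
  by (cases g) auto

text \<open>The longest round, for a quantified literal, executes instructions 4 to 21 except 13 and
  14, which skip child lists: 16 steps.\<close>

lemma loop_step:
  assumes "loop_inv N L a (g # gs) s"
  shows "\<exists>t s'. t \<le> 16 \<and> (step forget_prog ^^ t) s = s' \<and>
    loop_inv N L (a + length (gate_words g)) gs s' \<and>
    (\<forall>i < length (gate_words g). mem s' (a + i) = gate_words (forget_gate L g) ! i) \<and>
    (\<forall>b < a. mem s' b = mem s b)"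
proof -
  let ?n = "length (gate_words g)"
  define ws where "ws = concat (map gate_words gs)"
  obtain p r m where s: "s = Config p r m"
    by (cases s)
  have r: "p = 4" "r 0 = 0" "r (Suc 0) = N" "r 2 = 1" "r 9 = 2" "r 3 = Suc (length gs)" "r 4 = a"
    and len: "a + (?n + length ws) \<le> N"
    and m: "\<And>i. i < ?n + length ws \<Longrightarrow> m (a + i) = (gate_words g @ ws) ! i"
    and table: "\<And>k. m (N + k) = of_bool (k \<in> lit_code ` L)"
    using assms by (auto simp: loop_inv_def s ws_def Let_def)
  have head: "m (a + i) = gate_words g ! i" if "i < ?n" for i
    using m[of i] that by (simp add: nth_append)
  have tail: "m (a + ?n + i) = ws ! i" if "i < length ws" for i
    using m[of "?n + i"] that by (simp add: add.assoc)
  \<comment> \<open>Every gate encoding has at least two words, so both reads are uniform in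
    \<open>g\<close>.\<close>
  have m01: "m a = gate_words g ! 0" "m (Suc a) = gate_words g ! 1"
    using head[of 0] head[of 1] by (cases g; simp)+
  \<comment> \<open>A round changes no memory from \<open>a + ?n\<close> on, which covers the unread
    gates and the table.\<close>
  have invI: "loop_inv N L (a + ?n) gs (Config 4 r' m')"
    if "r' 0 = 0" "r' 1 = N" "r' 2 = 1" "r' 9 = 2" "r' 3 = length gs" "r' 4 = a + ?n"
      "\<And>b. a + ?n \<le> b \<Longrightarrow> m' b = m b" for r' m'
  proof -
    have "\<forall>i < length ws. m' (a + ?n + i) = ws ! i"
      using tail that(7) by simp
    moreover have "m' (N + k) = of_bool (k \<in> lit_code ` L)" for k
      using len table that(7)[of "N + k"] by simp
    ultimately show ?thesis
      using that(1-6) len by (simp add: loop_inv_def Let_def flip: ws_def)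
  qed
  note run = funpow_numeral step_forget_prog nth_forget_prog r m01
  show ?thesis
  proof (cases g)
    case (Const b)
    have "\<exists>r'. (step forget_prog ^^ 7) s = Config 4 r' m \<and>
        r' 0 = 0 \<and> r' 1 = N \<and> r' 2 = 1 \<and> r' 9 = 2 \<and> r' 3 = length gs \<and> r' 4 = a + ?n"
      by (simp add: s run Const)
    with invI head show ?thesis
      by (intro exI[of _ 7]) (auto simp: Const s)
  next
    case (Literal l)
    have code: "m (lit_code l + N) = of_bool (l \<in> L)"
      using table[of "lit_code l"] by (simp add: add.commute inj_image_mem_iff[OF inj_lit_code])
    show ?thesis
    proof (cases "l \<in> L")
      case True
      \<comment> \<open>\<open>[1, lit_code l]\<close> is overwritten by \<open>[0, 1]\<close>, the
        encoding of \<open>Const True\<close>.\<close>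
      let ?m = "m(Suc a := 1, a := 0)"
      have "\<exists>r'. (step forget_prog ^^ 16) s = Config 4 r' ?m \<and>
          r' 0 = 0 \<and> r' 1 = N \<and> r' 2 = 1 \<and> r' 9 = 2 \<and> r' 3 = length gs \<and> r' 4 = a + ?n"
        by (simp add: s run Literal code True)
      with invI[of _ ?m] show ?thesis
        by (intro exI[of _ 16]) (auto simp: Literal True s less_Suc_eq)
    next
      case False
      have "\<exists>r'. (step forget_prog ^^ 12) s = Config 4 r' m \<and>
          r' 0 = 0 \<and> r' 1 = N \<and> r' 2 = 1 \<and> r' 9 = 2 \<and> r' 3 = length gs \<and> r' 4 = a + ?n"
        by (simp add: s run Literal code False)
      with invI head show ?thesis
        by (intro exI[of _ 12]) (auto simp: Literal False s)
    qed
  next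
    case (And js)
    \<comment> \<open>The second word is the number of children; adding it to the address skips
      their list.\<close>
    have "\<exists>r'. (step forget_prog ^^ 11) s = Config 4 r' m \<and>
        r' 0 = 0 \<and> r' 1 = N \<and> r' 2 = 1 \<and> r' 9 = 2 \<and> r' 3 = length gs \<and> r' 4 = a + ?n"
      by (simp add: s run And)
    with invI head show ?thesis
      by (intro exI[of _ 11]) (auto simp: And s)
  next
    case (Or js)
    have "\<exists>r'. (step forget_prog ^^ 11) s = Config 4 r' m \<and>
        r' 0 = 0 \<and> r' 1 = N \<and> r' 2 = 1 \<and> r' 9 = 2 \<and> r' 3 = length gs \<and> r' 4 = a + ?n"
      by (simp add: s run Or)
    with invI head show ?thesis
      by (intro exI[of _ 11]) (auto simp: Or s)
  qed
qed

text \<open>At most 16 steps per gate, plus the final exit jump. The frame clause protects gates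
  rewritten in earlier rounds.\<close>

lemma loop:
  assumes "loop_inv N L a gs s"
  shows "\<exists>t s'. t \<le> 16 * length gs + 1 \<and> (step forget_prog ^^ t) s = s' \<and>
    halted forget_prog s' \<and> regs s' 0 = 0 \<and>
    (let ws = concat (map gate_words (map (forget_gate L) gs)) in
      \<forall>i < length ws. mem s' (a + i) = ws ! i) \<and>
    (\<forall>b < a. mem s' b = mem s b)"
  using assms
proof (induction gs arbitrary: a s)
  case Nil
  then obtain r m where "s = Config 4 r m" "r 0 = 0" "r 3 = 0"
    by (cases s) (auto simp: loop_inv_def)
  \<comment> \<open>Instruction 4 jumps to 22, the length of the program.\<close>
  then show ?case
    by (intro exI[of _ 1]) (simp add: step_forget_prog, simp add: halted_def forget_prog_def)
next
  case (Cons g gs)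
  let ?n = "length (gate_words g)"
  obtain t s' where t: "t \<le> 16" "(step forget_prog ^^ t) s = s'"
    "loop_inv N L (a + ?n) gs s'"
    "\<And>i. i < ?n \<Longrightarrow> mem s' (a + i) = gate_words (forget_gate L g) ! i"
    "\<And>b. b < a \<Longrightarrow> mem s' b = mem s b"
    using loop_step[OF Cons.prems] by blast
  define ws where "ws = concat (map gate_words (map (forget_gate L) gs))"
  obtain t' s'' where t': "t' \<le> 16 * length gs + 1" "(step forget_prog ^^ t') s' = s''"
    "halted forget_prog s''" "regs s'' 0 = 0"
    "\<And>i. i < length ws \<Longrightarrow> mem s'' (a + ?n + i) = ws ! i"
    "\<And>b. b < a + ?n \<Longrightarrow> mem s'' b = mem s' b"
    using Cons.IH[OF t(3)] unfolding Let_def ws_def by metis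
  have "(step forget_prog ^^ (t' + t)) s = s''"
    using t(2) t'(2) by (simp add: funpow_add)
  moreover have "mem s'' (a + i) = (gate_words (forget_gate L g) @ ws) ! i"
    if "i < ?n + length ws" for i
  proof (cases "i < ?n")
    case True
    then show ?thesis
      using t(4) t'(6) by (simp add: nth_append)
  next
    case False
    then show ?thesis
      using t'(5)[of "i - ?n"] that by (simp add: nth_append)
  qed
  ultimately show ?case
    using t t' by (intro exI[of _ "t' + t"]) (simp add: Let_def ws_def)
qed

text \<open>The 5 counts four set-up instructions and the exit jump. The loop starts at address 2,
  behind the root and the gate count, both kept by \<open>forget\<close>.\<close>

lemma forget_prog_correct:
  "\<exists>t s. t \<le> 16 * length (gates C) + 5 \<and> (step forget_prog ^^ t) (initial C L) = s \<and>
    halted forget_prog s \<and> outputs s (forget L C)"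
proof -
  let ?ws = "circuit_words C"
  let ?s = "initial C L"
  define N where "N = length ?ws"
  define s where "s = (step forget_prog ^^ 4) ?s"
  obtain r where init: "?s = Config 0 r (mem ?s)" "r = (\<lambda>_. 0)(1 := N)"
    by (simp add: initial_def Let_def N_def)
  have mem: "mem ?s b = ?ws ! b" if "b < N" for b
    using that by (simp add: initial_def Let_def N_def)
  have table: "mem ?s (N + k) = of_bool (k \<in> lit_code ` L)" for k
    by (simp add: initial_def Let_def N_def)
  have "mem ?s 0 = root C" "mem ?s (Suc 0) = length (gates C)"
    using mem[of 0] mem[of 1] by (simp_all add: N_def circuit_words_def)
  then have s: "s = Config 4 (r(2 := 1, 3 := length (gates C), 4 := 2, 9 := 2)) (mem ?s)"
    unfolding s_def by (subst init(1)) (simp add: funpow_numeral step_forget_prog nth_forget_prog)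
  have "loop_inv N L 2 (gates C) s"
    using mem table by (simp add: loop_inv_def Let_def s init(2) N_def circuit_words_def)
  from loop[OF this] obtain t s' where t: "t \<le> 16 * length (gates C) + 1"
    "(step forget_prog ^^ t) s = s'" "halted forget_prog s'" "regs s' 0 = 0"
    "\<And>i. i < length (concat (map gate_words (gates (forget L C)))) \<Longrightarrow>
       mem s' (2 + i) = concat (map gate_words (gates (forget L C))) ! i"
    "\<And>b. b < 2 \<Longrightarrow> mem s' b = mem s b"
    unfolding Let_def forget_simps by metis
  have "(step forget_prog ^^ (t + 4)) ?s = s'"
    using t(2) by (simp add: funpow_add s_def)
  moreover have "mem s' i = circuit_words (forget L C) ! i"
    if "i < length (circuit_words (forget L C))" for i
  proof -
    consider "i = 0" | "i = 1" | k where "i = 2 + k"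
      by (metis One_nat_def add_2_eq_Suc old.nat.exhaust)
    then show ?thesis
    proof cases
      case 3
      with that t(5)[of k] show ?thesis
        by (simp add: circuit_words_def)
    qed (use t(6) s \<open>mem ?s 0 = _\<close> \<open>mem ?s (Suc 0) = _\<close> in \<open>simp_all add: circuit_words_def\<close>)
  qed
  ultimately show ?thesis
    using t by (intro exI[of _ "t + 4"]) (simp add: outputs_def)
qed

theorem proposition23:
  "\<exists>(P :: instr list) (c :: nat). \<forall>(C :: circuit) (L :: lit set).
     decision_dnnf C \<and> finite L \<longrightarrow>
       (\<exists>t s D. t \<le> c * circuit_size C \<and>
          (step P ^^ t) (initial C L) = s \<and> halted P s \<and> outputs s D \<and>
          dnnf D \<and>
          (\<forall>ls. distinct ls \<and> set ls = L \<longrightarrow> equivalent D (exists_lits ls C)))"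
\<comment> \<open>The root is a gate, so \<open>16 * n + 5\<close> is at most \<open>21 * n\<close>
  for the number \<open>n\<close> of gates, which the size bounds from above.\<close>
proof (rule exI[of _ forget_prog], rule exI[of _ 21], intro allI impI)
  fix C and L :: "lit set"
  assume "decision_dnnf C \<and> finite L"
  then have C: "dnnf C" "0 < length (gates C)"
    by (auto simp: decision_dnnf_def dnnf_def nnf_def)
  obtain t s where t: "t \<le> 16 * length (gates C) + 5"
    "(step forget_prog ^^ t) (initial C L) = s" "halted forget_prog s" "outputs s (forget L C)"
    using forget_prog_correct by blast
  have "t \<le> 21 * circuit_size C"
    using t(1) gr0_implies_Suc[OF C(2)] by (auto simp: circuit_size_def)
  with t dnnf_forget[OF C(1)] equivalent_forget_exists_lits[OF C(1)]
  show "\<exists>t s D. t \<le> 21 * circuit_size C \<and>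
          (step forget_prog ^^ t) (initial C L) = s \<and> halted forget_prog s \<and> outputs s D \<and>
          dnnf D \<and>
          (\<forall>ls. distinct ls \<and> set ls = L \<longrightarrow> equivalent D (exists_lits ls C))"
    by blast
qed

end
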